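(* Let $n\geq 2$ and let $\mathfrak{o}(n)$ be the Lie algebra of real antisymmetric $n\times n$ matrices with the commutator bracket, with basis $\{e_{ij}\}_{1\le i<j\le n}$, where $e_{ij}$ has entry $1$ in row $i$, column $j$, entry $-1$ in row $j$, column $i$, and zeros elsewhere. In $\mathfrak{o}(n)\times\mathfrak{o}(n)$ write $e_{ij}$ for $(e_{ij},0)$ and $e_{ij}^*$ for $(0,e_{ij})$. Let $\mathcal{J}$ be the $\mathbb{R}$-linear endomorphism of $\mathfrak{o}(n)\times\mathfrak{o}(n)$ with $\mathcal{J}^2=-\mathrm{id}$ determined by the following rules, for every odd integer $k$ with $1\le k$ and $k+1\leq n$: $$\mathcal{J}e_{k(k+1)}=e_{k(k+1)}^*,\qquad \mathcal{J}e_{ki}=e_{(k+1)i}\ \text{ and }\ \mathcal{J}e_{ki}^*=e_{(k+1)i}^*\quad\text{for all } i \text{ with } k+1<i\leq n.$$ Then the complex structure $\mathcal{J}$ on the Lie algebra $\mathfrak{o}(n)\times\mathfrak{o}(n)$ is integrable.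
   Context: The bracket on $\mathfrak{o}(n)\times\mathfrak{o}(n)$ is componentwise: $[(u,v),(t,s)]=([u,t],[v,s])$. A complex structure on a real Lie algebra $\mathfrak{h}$ is an $\mathbb{R}$-linear endomorphism $\mathcal{J}:\mathfrak{h}\to\mathfrak{h}$ with $\mathcal{J}^2=-\mathrm{id}$. It is integrable if for all $v,w\in\mathfrak{h}$ $$N(v,w):=[v,w]+\mathcal{J}[\mathcal{J}v,w]+\mathcal{J}[v,\mathcal{J}w]-[\mathcal{J}v,\mathcal{J}w]=0.$$ The rules for $\mathcal{J}$ give its values on one vector from each of a collection of disjoint pairs of basis vectors exhausting the basis $\{e_{ij},e_{ij}^*\}_{i<j}$; the values on the other vectors of the pairs are forced by $\mathcal{J}^2=-\mathrm{id}$ (for instance $\mathcal{J}e_{k(k+1)}^*=-e_{k(k+1)}$ and $\mathcal{J}e_{(k+1)i}=-e_{ki}$). *)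

theory Defs
  imports "Jordan_Normal_Form.Matrix" "HOL-Library.Product_Plus"
begin

definition so_alg :: "nat \<Rightarrow> real mat set" where
  "so_alg n = {A \<in> carrier_mat n n. transpose_mat A = - A}"

definition mat_bracket :: "real mat \<Rightarrow> real mat \<Rightarrow> real mat" where
  "mat_bracket A B = A * B - B * A"

(* Matrices of type mat are indexed from 0, whereas i and j range over 1..n. *)
definition e_mat :: "nat \<Rightarrow> nat \<Rightarrow> nat \<Rightarrow> real mat" where
  "e_mat n i j = mat n n (\<lambda>(r, c).
     if r + 1 = i \<and> c + 1 = j then 1
     else if r + 1 = j \<and> c + 1 = i then - 1
     else 0)"

text \<open>
  The operations \<open>+\<close>, \<open>-\<close> and unary minus on pairs of matrices are the componentwise ones of
  \<^theory>\<open>HOL-Library.Product_Plus\<close>; the zero vector depends on the dimension and is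
  written out below.
\<close>

type_synonym mat_pair = "real mat \<times> real mat"

definition so_prod :: "nat \<Rightarrow> mat_pair set" where
  "so_prod n = so_alg n \<times> so_alg n"

definition pair_zero :: "nat \<Rightarrow> mat_pair" where
  "pair_zero n = (0\<^sub>m n n, 0\<^sub>m n n)"

definition pair_scale :: "real \<Rightarrow> mat_pair \<Rightarrow> mat_pair" where
  "pair_scale c x = (c \<cdot>\<^sub>m fst x, c \<cdot>\<^sub>m snd x)"

definition pair_bracket :: "mat_pair \<Rightarrow> mat_pair \<Rightarrow> mat_pair" where
  "pair_bracket x y = (mat_bracket (fst x) (fst y), mat_bracket (snd x) (snd y))"

definition e_left :: "nat \<Rightarrow> nat \<Rightarrow> nat \<Rightarrow> mat_pair" where
  "e_left n i j = (e_mat n i j, 0\<^sub>m n n)"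

definition e_right :: "nat \<Rightarrow> nat \<Rightarrow> nat \<Rightarrow> mat_pair" where
  "e_right n i j = (0\<^sub>m n n, e_mat n i j)"

definition linear_endo :: "nat \<Rightarrow> (mat_pair \<Rightarrow> mat_pair) \<Rightarrow> bool" where
  "linear_endo n J \<longleftrightarrow>
     (\<forall>x \<in> so_prod n. J x \<in> so_prod n) \<and>
     (\<forall>x \<in> so_prod n. \<forall>y \<in> so_prod n. J (x + y) = J x + J y) \<and>
     (\<forall>c. \<forall>x \<in> so_prod n. J (pair_scale c x) = pair_scale c (J x))"

definition complex_structure :: "nat \<Rightarrow> (mat_pair \<Rightarrow> mat_pair) \<Rightarrow> bool" where
  "complex_structure n J \<longleftrightarrow> linear_endo n J \<and> (\<forall>x \<in> so_prod n. J (J x) = - x)"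

definition nijenhuis :: "(mat_pair \<Rightarrow> mat_pair) \<Rightarrow> mat_pair \<Rightarrow> mat_pair \<Rightarrow> mat_pair" where
  "nijenhuis J v w =
     pair_bracket v w + J (pair_bracket (J v) w) + J (pair_bracket v (J w))
       - pair_bracket (J v) (J w)"

definition integrable_structure :: "nat \<Rightarrow> (mat_pair \<Rightarrow> mat_pair) \<Rightarrow> bool" where
  "integrable_structure n J \<longleftrightarrow>
     (\<forall>v \<in> so_prod n. \<forall>w \<in> so_prod n. nijenhuis J v w = pair_zero n)"

definition basis_rules :: "nat \<Rightarrow> (mat_pair \<Rightarrow> mat_pair) \<Rightarrow> bool" where
  "basis_rules n J \<longleftrightarrow>
     (\<forall>k. odd k \<and> k + 1 \<le> n \<longrightarrow>
        J (e_left n k (k + 1)) = e_right n k (k + 1) \<and>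
        (\<forall>i. k + 1 < i \<and> i \<le> n \<longrightarrow>
           J (e_left n k i) = e_left n (k + 1) i \<and>
           J (e_right n k i) = e_right n (k + 1) i))"

text \<open>
  The rules are satisfiable: an endomorphism with these properties exists for every \<open>n\<close>.
  The witness is given by the entries above the diagonal, with rows and columns counted from 0.
\<close>

definition J_upper :: "real \<Rightarrow> real mat \<Rightarrow> real mat \<Rightarrow> nat \<Rightarrow> nat \<Rightarrow> real" where
  "J_upper s A B r c =
     (if odd r then A $$ (r - 1, c)
      else if c = r + 1 then s * B $$ (r, c)
      else - A $$ (r + 1, c))"

definition J_comp :: "nat \<Rightarrow> real \<Rightarrow> real mat \<Rightarrow> real mat \<Rightarrow> real mat" where
  "J_comp n s A B = mat n n (\<lambda>(r, c).
     if r < c then J_upper s A B r c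
     else if c < r then - J_upper s A B c r
     else 0)"

definition J_wit :: "nat \<Rightarrow> mat_pair \<Rightarrow> mat_pair" where
  "J_wit n x = (J_comp n (- 1) (fst x) (snd x), J_comp n 1 (snd x) (fst x))"

lemma so_alg_entry:
  assumes "A \<in> so_alg n" "r < n" "c < n"
  shows "A $$ (c, r) = - A $$ (r, c)"
proof -
  have A: "A \<in> carrier_mat n n" and t: "transpose_mat A = - A"
    using assms by (auto simp: so_alg_def)
  have "transpose_mat A $$ (r, c) = (- A) $$ (r, c)" using t by simp
  then show ?thesis using A assms by auto
qed

lemma so_alg_carrier: "A \<in> so_alg n \<Longrightarrow> A \<in> carrier_mat n n"
  by (simp add: so_alg_def)

lemma J_comp_so_alg: "J_comp n s A B \<in> so_alg n"
  unfolding so_alg_def J_comp_def by (auto intro!: eq_matI)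

lemma J_comp_add:
  assumes "A \<in> carrier_mat n n" "B \<in> carrier_mat n n" "C \<in> carrier_mat n n" "D \<in> carrier_mat n n"
  shows "J_comp n s (A + C) (B + D) = J_comp n s A B + J_comp n s C D"
  using assms by (intro eq_matI) (auto simp: J_comp_def J_upper_def algebra_simps)

lemma J_comp_scale:
  assumes "A \<in> carrier_mat n n" "B \<in> carrier_mat n n"
  shows "J_comp n s (a \<cdot>\<^sub>m A) (a \<cdot>\<^sub>m B) = a \<cdot>\<^sub>m J_comp n s A B"
  using assms by (intro eq_matI) (auto simp: J_comp_def J_upper_def algebra_simps)

lemma J_comp_twice:
  assumes A: "A \<in> so_alg n" and s: "s * t = - 1"
  shows "J_comp n s (J_comp n s A B) (J_comp n t B A) = - A"
proof -
  note Ac = so_alg_carrier[OF A]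
  have up: "J_upper s (J_comp n s A B) (J_comp n t B A) r c = - A $$ (r, c)"
    if "r < c" "c < n" for r c
  proof (cases "odd r")
    case True
    then show ?thesis using that by (auto simp: J_comp_def J_upper_def)
  next
    case False
    have st: "s * (t * x) = - x" for x
      using s by (metis mult.assoc mult_minus1)
    show ?thesis
      using that False st by (auto simp: J_comp_def J_upper_def)
  qed
  have diag: "A $$ (r, r) = 0" if "r < n" for r
    using so_alg_entry[OF A that that] by simp
  show ?thesis
  proof (rule eq_matI)
    fix r c assume "r < dim_row (- A)" "c < dim_col (- A)"
    then have rc: "r < n" "c < n" using Ac by auto
    have "J_comp n s (J_comp n s A B) (J_comp n t B A) $$ (r, c) =
      (if r < c then - A $$ (r, c) else if c < r then A $$ (c, r) else 0)"
      unfolding J_comp_def[of n s "J_comp n s A B"] using rc up by auto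
    also have "\<dots> = (- A) $$ (r, c)"
      using rc Ac so_alg_entry[OF A, of c r] diag by (auto simp: not_less_iff_gr_or_eq)
    finally show "J_comp n s (J_comp n s A B) (J_comp n t B A) $$ (r, c) = (- A) $$ (r, c)" .
  qed (use Ac in \<open>auto simp: J_comp_def\<close>)
qed

lemma J_comp_eqI:
  assumes X: "X \<in> so_alg n"
    and up: "\<And>r c. r < c \<Longrightarrow> c < n \<Longrightarrow> J_upper s A B r c = X $$ (r, c)"
  shows "J_comp n s A B = X"
proof (rule eq_matI)
  fix r c assume "r < dim_row X" "c < dim_col X"
  then have rc: "r < n" "c < n" using so_alg_carrier[OF X] by auto
  show "J_comp n s A B $$ (r, c) = X $$ (r, c)"
    using rc up[of r c] up[of c r] so_alg_entry[OF X rc] so_alg_entry[OF X rc(1) rc(1)]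
    by (cases r c rule: linorder_cases) (auto simp: J_comp_def)
qed (use so_alg_carrier[OF X] in \<open>auto simp: J_comp_def\<close>)

lemma e_mat_so_alg: "i \<noteq> j \<Longrightarrow> e_mat n i j \<in> so_alg n"
  unfolding so_alg_def e_mat_def by (auto intro!: eq_matI)

lemma zero_so_alg: "0\<^sub>m n n \<in> so_alg n"
  unfolding so_alg_def by (auto intro!: eq_matI)

lemma e_mat_upper:
  assumes "r < c" "c < n" "i < j"
  shows "e_mat n i j $$ (r, c) = (if r + 1 = i \<and> c + 1 = j then 1 else 0)"
  using assms by (simp add: e_mat_def)

lemma J_upper_pair:
  assumes "odd k" "r < c" "c < n"
  shows "J_upper 1 (0\<^sub>m n n) (e_mat n k (k + 1)) r c = e_mat n k (k + 1) $$ (r, c)"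
    and "J_upper (- 1) (e_mat n k (k + 1)) (0\<^sub>m n n) r c = 0"
  using assms by (auto simp: J_upper_def e_mat_upper)

lemma J_upper_row:
  assumes "odd k" "k + 1 < i" "r < c" "c < n"
  shows "J_upper s (e_mat n k i) (0\<^sub>m n n) r c = e_mat n (k + 1) i $$ (r, c)"
    and "J_upper s (0\<^sub>m n n) (e_mat n k i) r c = 0"
  using assms by (auto simp: J_upper_def e_mat_upper)

lemma J_comp_pair:
  assumes "odd k"
  shows "J_comp n 1 (0\<^sub>m n n) (e_mat n k (k + 1)) = e_mat n k (k + 1)"
    and "J_comp n (- 1) (e_mat n k (k + 1)) (0\<^sub>m n n) = 0\<^sub>m n n"
  by (rule J_comp_eqI; simp add: e_mat_so_alg zero_so_alg
      J_upper_pair[OF assms, unfolded Suc_eq_plus1[symmetric]])+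

lemma J_comp_row:
  assumes "odd k" "k + 1 < i"
  shows "J_comp n s (e_mat n k i) (0\<^sub>m n n) = e_mat n (k + 1) i"
    and "J_comp n s (0\<^sub>m n n) (e_mat n k i) = 0\<^sub>m n n"
  using assms
  by (auto intro!: J_comp_eqI
      simp: e_mat_so_alg zero_so_alg J_upper_row[unfolded Suc_eq_plus1[symmetric]])

lemma ex_complex_structure_basis_rules: "\<exists>J. complex_structure n J \<and> basis_rules n J"
proof (intro exI conjI)
  show "complex_structure n (J_wit n)"
    unfolding complex_structure_def linear_endo_def
    by (auto simp: J_wit_def so_prod_def pair_scale_def J_comp_so_alg J_comp_add J_comp_scale
        J_comp_twice so_alg_carrier)
  show "basis_rules n (J_wit n)"
    unfolding basis_rules_def J_wit_def e_left_def e_right_def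
    using J_comp_pair J_comp_row by simp
qed

end

theory Submission
  imports Defs
begin

text \<open>
  The rules determine \<open>J\<close>, so it is the explicit endomorphism \<open>J_wit\<close>. Off the \<open>2 \<times> 2\<close> diagonal
  blocks it rotates each pair of rows \<open>r\<close>, \<open>r + 1\<close> (\<open>r\<close> even, counting from 0), and
  the entries of the Nijenhuis tensor are sums \<open>\<Sum>t<n\<close>. For such \<open>r\<close> the terms with
  \<open>t > r + 1\<close> cancel one by one because \<open>J\<close> rotates rows \<open>r\<close> and \<open>r + 1\<close>; the terms with
  \<open>t < r\<close> cancel in pairs \<open>t\<close>, \<open>t + 1\<close> because a rotation by a right angle is orthogonal and
  skew; and the terms \<open>t = r\<close> and \<open>t = r + 1\<close> cancel each other. Odd rows reduce to even ones by
  replacing \<open>(v, J v)\<close> with \<open>(J v, - v)\<close>.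
\<close>

section \<open>Antisymmetric matrices\<close>

lemma so_alg_add: "A \<in> so_alg n \<Longrightarrow> B \<in> so_alg n \<Longrightarrow> A + B \<in> so_alg n"
  by (auto simp: so_alg_def transpose_add intro!: eq_matI)

lemma so_alg_scale:
  assumes "A \<in> so_alg n"
  shows "a \<cdot>\<^sub>m A \<in> so_alg n"
proof -
  have "A \<in> carrier_mat n n" "transpose_mat A = - A" using assms by (auto simp: so_alg_def)
  moreover have "transpose_mat (a \<cdot>\<^sub>m A) = a \<cdot>\<^sub>m transpose_mat A" by (intro eq_matI) auto
  moreover have "a \<cdot>\<^sub>m - A = - (a \<cdot>\<^sub>m A)" by (intro eq_matI) auto
  ultimately show ?thesis by (simp add: so_alg_def)
qed

lemma so_alg_uminus: "A \<in> so_alg n \<Longrightarrow> - A \<in> so_alg n"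
  by (auto simp: so_alg_def transpose_uminus)

lemma so_alg_minus: "A \<in> so_alg n \<Longrightarrow> B \<in> so_alg n \<Longrightarrow> A - B \<in> so_alg n"
  using so_alg_add[OF _ so_alg_uminus, of A n B] minus_add_uminus_mat[of A n n B]
  by (simp add: so_alg_carrier)

lemma so_alg_bracket:
  assumes "A \<in> so_alg n" "B \<in> so_alg n"
  shows "mat_bracket A B \<in> so_alg n"
proof -
  have car: "A \<in> carrier_mat n n" "B \<in> carrier_mat n n"
    and t: "transpose_mat A = - A" "transpose_mat B = - B"
    using assms by (auto simp: so_alg_def)
  have "transpose_mat (A * B) = B * A" "transpose_mat (B * A) = A * B"
    using car by (simp_all add: transpose_mult[of _ n n _ n] t)
  moreover have "transpose_mat (A * B - B * A) = transpose_mat (A * B) - transpose_mat (B * A)"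
    using car by (intro transpose_minus) auto
  moreover have "B * A - A * B = - (A * B - B * A)" using car by (intro eq_matI) auto
  moreover have "A * B - B * A \<in> carrier_mat n n" using car by auto
  ultimately show ?thesis by (simp add: so_alg_def mat_bracket_def)
qed

lemma so_alg_eq_zeroI:
  assumes "X \<in> so_alg n" and "\<And>r c. r < c \<Longrightarrow> c < n \<Longrightarrow> X $$ (r, c) = 0"
  shows "X = 0\<^sub>m n n"
proof (rule eq_matI)
  fix r c assume "r < dim_row (0\<^sub>m n n :: real mat)" "c < dim_col (0\<^sub>m n n :: real mat)"
  then show "X $$ (r, c) = 0\<^sub>m n n $$ (r, c)"
    using so_alg_entry[OF assms(1), of r c] so_alg_entry[OF assms(1), of r r] assms(2)
    by (cases r c rule: linorder_cases) fastforce+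
qed (use so_alg_carrier[OF assms(1)] in auto)

text \<open>The \<open>e_mat n i j\<close> with \<open>i < j\<close> span, so linear statements need
  checking only on them; the uniqueness of \<open>J\<close> is proved this way in each
  factor.\<close>

lemma so_alg_induct [consumes 1, case_names zero add scale basis]:
  assumes A: "A \<in> so_alg n"
    and zero: "P (0\<^sub>m n n)"
    and add: "\<And>A B. A \<in> so_alg n \<Longrightarrow> B \<in> so_alg n \<Longrightarrow> P A \<Longrightarrow> P B \<Longrightarrow> P (A + B)"
    and scale: "\<And>a A. A \<in> so_alg n \<Longrightarrow> P A \<Longrightarrow> P (a \<cdot>\<^sub>m A)"
    and basis: "\<And>i j. 1 \<le> i \<Longrightarrow> i < j \<Longrightarrow> j \<le> n \<Longrightarrow> P (e_mat n i j)"
  shows "P A"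
proof -
  \<comment> \<open>\<open>S\<close> contains every position above the diagonal where
    \<open>A\<close> is nonzero; the induction clears one position at a time.\<close>
  have "P A" if "finite S" "S \<subseteq> {(r, c). r < c \<and> c < n}" "A \<in> so_alg n"
    "\<And>r c. r < c \<Longrightarrow> c < n \<Longrightarrow> (r, c) \<notin> S \<Longrightarrow> A $$ (r, c) = 0" for S A
    using that
  proof (induction S arbitrary: A rule: finite_induct)
    case empty
    then show ?case using so_alg_eq_zeroI[of A n] zero by auto
  next
    case (insert p S)
    obtain i j where p: "p = (i, j)" and ij: "i < j" "j < n" using insert.prems by auto
    \<comment> \<open>Entries are indexed from 0 but \<open>e_mat\<close> counts from 1, hence the
      shift.\<close>
    define E where "E = A $$ (i, j) \<cdot>\<^sub>m e_mat n (i + 1) (j + 1)"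
    have E: "E \<in> so_alg n" "P E"
      using ij by (auto simp: E_def e_mat_so_alg so_alg_scale intro!: scale basis)
    have Ac: "A \<in> carrier_mat n n" "E \<in> carrier_mat n n"
      using insert.prems(2) E(1) by (auto dest: so_alg_carrier)
    have "P (A - E)"
    proof (rule insert.IH)
      show "A - E \<in> so_alg n" using insert.prems(2) E(1) by (rule so_alg_minus)
      show "(A - E) $$ (r, c) = 0" if "r < c" "c < n" "(r, c) \<notin> S" for r c
        using insert.prems(3)[of r c] that Ac p ij by (auto simp: E_def e_mat_def)
    qed (use insert.prems in auto)
    moreover have "A = (A - E) + E" using Ac by (intro eq_matI) auto
    ultimately show ?case
      using add[OF so_alg_minus[OF insert.prems(2) E(1)] E(1)] E(2) by metis
  qed
  moreover have "finite {(r, c). r < c \<and> c < n}"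
    by (rule finite_subset[of _ "{..<n} \<times> {..<n}"]) auto
  ultimately show ?thesis using A by blast
qed

section \<open>Uniqueness of the complex structure\<close>

lemma linear_endo_zero:
  assumes "linear_endo n J"
  shows "J (pair_zero n) = pair_zero n"
proof -
  have z: "pair_zero n \<in> so_prod n" by (simp add: pair_zero_def so_prod_def zero_so_alg)
  then have "J (pair_zero n) \<in> so_prod n" using assms by (simp add: linear_endo_def)
  moreover have "pair_scale 0 x = pair_zero n" if "x \<in> so_prod n" for x
    using that by (auto simp: pair_scale_def pair_zero_def so_prod_def so_alg_def intro!: eq_matI)
  ultimately show ?thesis using assms z unfolding linear_endo_def by metis
qed

text \<open>The rules give \<open>J\<close> on one vector of each pair; applying \<open>J\<close>
  once more and using that its square is minus the identity gives the other.\<close>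

lemma complex_structure_basis:
  assumes J: "complex_structure n J" "basis_rules n J" and ij: "1 \<le> i" "i < j" "j \<le> n"
  shows "J (e_left n i j) =
      (if even i then - e_left n (i - 1) j
       else if j = i + 1 then e_right n i j else e_left n (i + 1) j)"
    and "J (e_right n i j) =
      (if even i then - e_right n (i - 1) j
       else if j = i + 1 then - e_left n i j else e_right n (i + 1) j)"
proof -
  have in_prod: "e_left n k l \<in> so_prod n" "e_right n k l \<in> so_prod n" if "k \<noteq> l" for k l
    using that by (auto simp: e_left_def e_right_def so_prod_def e_mat_so_alg zero_so_alg)
  have sq: "J (J x) = - x" if "x \<in> so_prod n" for x
    using J(1) that by (simp add: complex_structure_def)
  have pair: "J (e_left n k (k + 1)) = e_right n k (k + 1)" if "odd k" "k + 1 \<le> n" for k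
    using J(2) that unfolding basis_rules_def by blast
  have row: "J (e_left n k l) = e_left n (k + 1) l" "J (e_right n k l) = e_right n (k + 1) l"
    if "odd k" "k + 1 < l" "l \<le> n" for k l
    using J(2) that unfolding basis_rules_def by auto
  have ev: "J (e_left n i j) = - e_left n (i - 1) j" "J (e_right n i j) = - e_right n (i - 1) j"
    if "even i"
  proof -
    \<comment> \<open>The row rule at \<open>i - 1\<close> exhibits the vectors with index
      \<open>i\<close> as images under \<open>J\<close>.\<close>
    have "odd (i - 1)" "i - 1 + 1 = i" using that ij by auto
    then show "J (e_left n i j) = - e_left n (i - 1) j" "J (e_right n i j) = - e_right n (i - 1) j"
      using row[of "i - 1" j] sq[OF in_prod(1), of "i - 1" j] sq[OF in_prod(2), of "i - 1" j] ij
      by auto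
  qed
  show "J (e_left n i j) =
      (if even i then - e_left n (i - 1) j
       else if j = i + 1 then e_right n i j else e_left n (i + 1) j)"
    using ev pair[of i] row[of i j] ij by auto
  show "J (e_right n i j) =
      (if even i then - e_right n (i - 1) j
       else if j = i + 1 then - e_left n i j else e_right n (i + 1) j)"
    using ev pair[of i] row[of i j] sq[OF in_prod(1), of i j] ij by auto
qed

lemma complex_structure_unique:
  assumes J: "complex_structure n J" "basis_rules n J"
    and K: "complex_structure n K" "basis_rules n K"
    and x: "x \<in> so_prod n"
  shows "J x = K x"
proof -
  have lin: "linear_endo n J" "linear_endo n K" using J K by (auto simp: complex_structure_def)
  have z: "J (0\<^sub>m n n, 0\<^sub>m n n) = K (0\<^sub>m n n, 0\<^sub>m n n)"
    using lin[THEN linear_endo_zero] by (simp add: pair_zero_def)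
  have plus: "J (y + z) = K (y + z)"
    if "y \<in> so_prod n" "z \<in> so_prod n" "J y = K y" "J z = K z" for y z
    using lin that by (simp add: linear_endo_def)
  have smult: "J (pair_scale a y) = K (pair_scale a y)" if "y \<in> so_prod n" "J y = K y" for a y
    using lin that by (simp add: linear_endo_def)
  have left: "J (A, 0\<^sub>m n n) = K (A, 0\<^sub>m n n)" if "A \<in> so_alg n" for A
    using that
  proof (induction rule: so_alg_induct)
    case (add A B)
    then show ?case
      using plus[of "(A, 0\<^sub>m n n)" "(B, 0\<^sub>m n n)"] by (simp add: so_prod_def zero_so_alg)
  next
    case (scale a A)
    then show ?case
      using smult[of "(A, 0\<^sub>m n n)" a]
      by (simp add: so_prod_def zero_so_alg pair_scale_def)
  next
    case (basis i j)
    then show ?case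
      using complex_structure_basis(1)[OF J] complex_structure_basis(1)[OF K]
      by (simp add: e_left_def)
  qed (rule z)
  have right: "J (0\<^sub>m n n, A) = K (0\<^sub>m n n, A)" if "A \<in> so_alg n" for A
    using that
  proof (induction rule: so_alg_induct)
    case (add A B)
    then show ?case
      using plus[of "(0\<^sub>m n n, A)" "(0\<^sub>m n n, B)"] by (simp add: so_prod_def zero_so_alg)
  next
    case (scale a A)
    then show ?case
      using smult[of "(0\<^sub>m n n, A)" a]
      by (simp add: so_prod_def zero_so_alg pair_scale_def)
  next
    case (basis i j)
    then show ?case
      using complex_structure_basis(2)[OF J] complex_structure_basis(2)[OF K]
      by (simp add: e_right_def)
  qed (rule z)
  obtain A B where "x = (A, B)" "A \<in> so_alg n" "B \<in> so_alg n" using x by (auto simp: so_prod_def)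
  moreover from this have "x = (A, 0\<^sub>m n n) + (0\<^sub>m n n, B)" by (simp add: so_alg_def)
  ultimately show ?thesis
    using plus[OF _ _ left right, of A B] by (simp add: so_prod_def zero_so_alg del: add_Pair)
qed

text \<open>The existence statement hides its witness, so this property and the next are recorded
  for \<open>J_wit\<close> itself.\<close>

lemma J_wit_complex_structure: "complex_structure n (J_wit n)"
  unfolding complex_structure_def linear_endo_def
  by (auto simp: J_wit_def so_prod_def pair_scale_def J_comp_so_alg J_comp_add J_comp_scale
      J_comp_twice so_alg_carrier)

lemma J_wit_basis_rules: "basis_rules n (J_wit n)"
  unfolding basis_rules_def J_wit_def e_left_def e_right_def
  using J_comp_pair J_comp_row by simp

section \<open>Entries of the Nijenhuis tensor\<close>

text \<open>This keeps what \<open>J\<close> does within one factor, to the right of the diagonal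
  blocks, and leaves out the block entries, where the two factors mix.\<close>

definition row_rotation :: "nat \<Rightarrow> real mat \<Rightarrow> real mat \<Rightarrow> bool" where
  "row_rotation n A A' \<longleftrightarrow>
     (\<forall>r c. even r \<longrightarrow> r + 1 < c \<longrightarrow> c < n \<longrightarrow>
        A' $$ (r, c) = - A $$ (r + 1, c) \<and> A' $$ (r + 1, c) = A $$ (r, c))"

lemma row_rotation_J_comp: "row_rotation n A (J_comp n s A B)"
  by (auto simp: row_rotation_def J_comp_def J_upper_def)

lemma row_rotation_uminus:
  assumes "A \<in> carrier_mat n n" "row_rotation n A A'"
  shows "row_rotation n A' (- A)"
  using assms by (auto simp: row_rotation_def)

text \<open>As \<open>r\<close> is even, the indices below \<open>r\<close> split into pairs
  \<open>2 * k\<close>, \<open>2 * k + 1\<close>. Both bracket computations below follow this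
  scheme.\<close>

lemma sum_rows_cancel:
  fixes f :: "nat \<Rightarrow> real"
  assumes "even r" "r + 1 < n"
    and below: "\<And>t. even t \<Longrightarrow> t + 1 < r \<Longrightarrow> f t + f (t + 1) = 0"
    and mid: "f r + f (r + 1) = 0"
    and above: "\<And>t. r + 1 < t \<Longrightarrow> t < n \<Longrightarrow> f t = 0"
  shows "(\<Sum>t<n. f t) = 0"
proof -
  obtain m where m: "r = 2 * m" using assms(1) by blast
  have "(\<Sum>t<2 * k. f t) = 0" if "k \<le> m" for k
    using that by (induction k) (use below m in auto)
  then have "(\<Sum>t<r + 2. f t) = 0" using m mid by simp
  moreover have "(\<Sum>t<r + 2. f t) = (\<Sum>t<n. f t)"
    using assms(2) above by (intro sum.mono_neutral_left) auto
  ultimately show ?thesis by simp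
qed

lemma bracket_entry:
  assumes "A \<in> so_alg n" "B \<in> so_alg n" "r < n" "c < n"
  shows "mat_bracket A B $$ (r, c) =
    (\<Sum>t<n. A $$ (r, t) * B $$ (t, c) - B $$ (r, t) * A $$ (t, c))"
proof -
  have "A \<in> carrier_mat n n" "B \<in> carrier_mat n n" using assms by (auto dest: so_alg_carrier)
  then show ?thesis
    using assms(3,4)
    by (simp add: mat_bracket_def scalar_prod_def atLeast0LessThan sum_subtractf)
qed

lemma bracket_uminus_entry:
  assumes "A \<in> so_alg n" "B \<in> so_alg n" "r < n" "c < n"
  shows "mat_bracket (- A) B $$ (r, c) = - mat_bracket A B $$ (r, c)"
proof -
  have "A \<in> carrier_mat n n" using assms by (auto dest: so_alg_carrier)
  then show ?thesis
    using assms by (simp add: bracket_entry[of _ n] so_alg_uminus algebra_simps flip: sum_negf)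
qed

text \<open>Since \<open>J\<close> fills an even row with minus the row below it, the left side is
  an entry of the Nijenhuis tensor outside the blocks.\<close>

lemma row_rotation_bracket:
  assumes so: "A \<in> so_alg n" "A' \<in> so_alg n" "B \<in> so_alg n" "B' \<in> so_alg n"
    and rot: "row_rotation n A A'" "row_rotation n B B'"
    and r: "even r" "r + 1 < c" and c: "c < n"
  shows "mat_bracket A B $$ (r, c) - mat_bracket A' B $$ (r + 1, c)
    - mat_bracket A B' $$ (r + 1, c) - mat_bracket A' B' $$ (r, c) = 0"
proof -
  have rotA: "A' $$ (t, d) = - A $$ (t + 1, d)" "A' $$ (t + 1, d) = A $$ (t, d)"
    and rotB: "B' $$ (t, d) = - B $$ (t + 1, d)" "B' $$ (t + 1, d) = B $$ (t, d)"
    if "even t" "t + 1 < d" "d < n" for t d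
    using rot that by (auto simp: row_rotation_def)
  define f where "f t =
    (A $$ (r, t) * B $$ (t, c) - B $$ (r, t) * A $$ (t, c))
    - (A' $$ (r + 1, t) * B $$ (t, c) - B $$ (r + 1, t) * A' $$ (t, c))
    - (A $$ (r + 1, t) * B' $$ (t, c) - B' $$ (r + 1, t) * A $$ (t, c))
    - (A' $$ (r, t) * B' $$ (t, c) - B' $$ (r, t) * A' $$ (t, c))" for t
  have "(\<Sum>t<n. f t) = 0"
  proof (rule sum_rows_cancel[OF r(1)])
    show "r + 1 < n" using r c by simp
    show "f t + f (t + 1) = 0" if t: "even t" "t + 1 < r" for t
    proof -
      \<comment> \<open>\<open>row_rotation\<close> speaks only of entries above the diagonal;
        antisymmetry moves these entries into rows \<open>t\<close> and \<open>t + 1\<close>, where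
        it applies.\<close>
      have flip: "X $$ (r, t) = - X $$ (t, r)" "X $$ (r, t + 1) = - X $$ (t + 1, r)"
        "X $$ (r + 1, t) = - X $$ (t, r + 1)" "X $$ (r + 1, t + 1) = - X $$ (t + 1, r + 1)"
        if "X \<in> so_alg n" for X
        by (rule so_alg_entry[OF that]; use t r c in linarith)+
      have lt: "t + 1 < r" "t + 1 < r + 1" "t + 1 < c" "r < n" "r + 1 < n" using t r c by auto
      show ?thesis
        unfolding f_def flip[OF so(1)] flip[OF so(2)] flip[OF so(3)] flip[OF so(4)]
          rotA[OF t(1) lt(1) lt(4)] rotA[OF t(1) lt(2) lt(5)] rotA[OF t(1) lt(3) c]
          rotB[OF t(1) lt(1) lt(4)] rotB[OF t(1) lt(2) lt(5)] rotB[OF t(1) lt(3) c]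
        by (simp add: algebra_simps)
    qed
    show "f r + f (r + 1) = 0"
    proof -
      \<comment> \<open>Antisymmetry leaves one unknown block entry per matrix, and the coefficient
        of each of the four cancels.\<close>
      have flip: "X $$ (r + 1, r) = - X $$ (r, r + 1)" "X $$ (r, r) = 0" "X $$ (r + 1, r + 1) = 0"
        if "X \<in> so_alg n" for X
        using so_alg_entry[OF that, of r "r + 1"] so_alg_entry[OF that, of r r]
          so_alg_entry[OF that, of "r + 1" "r + 1"] r c by auto
      show ?thesis
        unfolding f_def flip[OF so(1)] flip[OF so(2)] flip[OF so(3)] flip[OF so(4)]
          rotA[OF r c] rotB[OF r c]
        by (simp add: algebra_simps)
    qed
    \<comment> \<open>The factors from row \<open>t\<close> stay as they are, so \<open>t\<close>
      may lie on either side of \<open>c\<close>.\<close>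
    show "f t = 0" if "r + 1 < t" "t < n" for t
      unfolding f_def rotA[OF r(1) that] rotB[OF r(1) that] by (simp add: algebra_simps)
  qed
  then show ?thesis
    using r c so by (simp add: f_def bracket_entry sum_subtractf)
qed

text \<open>For \<open>t > r + 1\<close> the terms are, up to sign, 2 by 2 determinants, which a
  rotation preserves. For \<open>t < r\<close> each pair \<open>t\<close>, \<open>t + 1\<close>
  yields dot products, preserved as well. The remaining terms contain a diagonal entry.\<close>

lemma row_rotation_bracket_block:
  assumes so: "A \<in> so_alg n" "A' \<in> so_alg n" "B \<in> so_alg n" "B' \<in> so_alg n"
    and rot: "row_rotation n A A'" "row_rotation n B B'"
    and r: "even r" "r + 1 < n"
  shows "mat_bracket A B $$ (r, r + 1) = mat_bracket A' B' $$ (r, r + 1)"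
proof -
  have rotA: "A' $$ (t, d) = - A $$ (t + 1, d)" "A' $$ (t + 1, d) = A $$ (t, d)"
    and rotB: "B' $$ (t, d) = - B $$ (t + 1, d)" "B' $$ (t + 1, d) = B $$ (t, d)"
    if "even t" "t + 1 < d" "d < n" for t d
    using rot that by (auto simp: row_rotation_def)
  define f where "f t =
    (A $$ (r, t) * B $$ (t, r + 1) - B $$ (r, t) * A $$ (t, r + 1))
    - (A' $$ (r, t) * B' $$ (t, r + 1) - B' $$ (r, t) * A' $$ (t, r + 1))" for t
  have "(\<Sum>t<n. f t) = 0"
  proof (rule sum_rows_cancel[OF r])
    show "f t + f (t + 1) = 0" if t: "even t" "t + 1 < r" for t
    proof -
      have flip: "X $$ (r, t) = - X $$ (t, r)" "X $$ (r, t + 1) = - X $$ (t + 1, r)"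
        if "X \<in> so_alg n" for X
        by (rule so_alg_entry[OF that]; use t r in linarith)+
      have lt: "t + 1 < r" "t + 1 < r + 1" "r < n" using t r by auto
      show ?thesis
        unfolding f_def flip[OF so(1)] flip[OF so(2)] flip[OF so(3)] flip[OF so(4)]
          rotA[OF t(1) lt(1) lt(3)] rotA[OF t(1) lt(2) r(2)]
          rotB[OF t(1) lt(1) lt(3)] rotB[OF t(1) lt(2) r(2)]
        by (simp add: algebra_simps)
    qed
    show "f r + f (r + 1) = 0"
    proof -
      have diag: "X $$ (r, r) = 0" "X $$ (r + 1, r + 1) = 0" if "X \<in> so_alg n" for X
        using so_alg_entry[OF that, of r r] so_alg_entry[OF that, of "r + 1" "r + 1"] r by auto
      show ?thesis
        unfolding f_def diag[OF so(1)] diag[OF so(2)] diag[OF so(3)] diag[OF so(4)] by simp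
    qed
    show "f t = 0" if t: "r + 1 < t" "t < n" for t
    proof -
      have flip: "X $$ (t, r + 1) = - X $$ (r + 1, t)" if "X \<in> so_alg n" for X
        by (rule so_alg_entry[OF that]; use t r in linarith)+
      show ?thesis
        unfolding f_def flip[OF so(1)] flip[OF so(2)] flip[OF so(3)] flip[OF so(4)]
          rotA[OF r(1) t] rotB[OF r(1) t]
        by (simp add: algebra_simps)
    qed
  qed
  then show ?thesis
    using r so by (simp add: f_def bracket_entry sum_subtractf)
qed

text \<open>Primes stand for images under \<open>J\<close>, and \<open>C\<close>, \<open>D\<close>
  for the parts of the arguments in the other factor. Keeping \<open>s\<close> general lets one
  computation serve both factors.\<close>

lemma nijenhuis_component:
  assumes so: "A \<in> so_alg n" "A' \<in> so_alg n" "B \<in> so_alg n" "B' \<in> so_alg n"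
    and so2: "C \<in> so_alg n" "C' \<in> so_alg n" "D \<in> so_alg n" "D' \<in> so_alg n"
    and rot: "row_rotation n A A'" "row_rotation n B B'"
    and rot2: "row_rotation n C C'" "row_rotation n D D'"
  shows "mat_bracket A B + J_comp n s (mat_bracket A' B) (mat_bracket C' D)
    + J_comp n s (mat_bracket A B') (mat_bracket C D') - mat_bracket A' B' = 0\<^sub>m n n"
    (is "?X = _")
proof (rule so_alg_eq_zeroI)
  show "?X \<in> so_alg n"
    by (intro so_alg_minus so_alg_add so_alg_bracket J_comp_so_alg so)
  fix r c assume rc: "r < c" "c < n"
  have X: "?X $$ (r, c) = mat_bracket A B $$ (r, c)
      + J_upper s (mat_bracket A' B) (mat_bracket C' D) r c
      + J_upper s (mat_bracket A B') (mat_bracket C D') r c - mat_bracket A' B' $$ (r, c)"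
    using rc so[THEN so_alg_carrier] by (simp add: J_comp_def mat_bracket_def)
  have minus: "- A \<in> so_alg n" "row_rotation n A' (- A)" "- C \<in> so_alg n" "row_rotation n C' (- C)"
    using so so2 rot rot2 by (auto intro: so_alg_uminus row_rotation_uminus so_alg_carrier)
  consider "odd r" | "even r" "c = r + 1" | "even r" "r + 1 < c" using rc by linarith
  then show "?X $$ (r, c) = 0"
  proof cases
    case 1
    then have "even (r - 1)" "r - 1 + 1 = r" by auto
    then show ?thesis
      unfolding X
      \<comment> \<open>With \<open>A'\<close>, \<open>- A\<close> in place of \<open>A\<close>,
        \<open>A'\<close>, the identity for the even row \<open>r - 1\<close> becomes the one for
        row \<open>r\<close>.\<close>
      using row_rotation_bracket[OF so(2) minus(1) so(3,4) minus(2) rot(2), of "r - 1" c] rc 1 so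
      by (simp add: J_upper_def bracket_uminus_entry)
  next
    case 2
    \<comment> \<open>On the block \<open>J\<close> reads the other factor, so its two contributions
      must cancel each other.\<close>
    have "mat_bracket C' D $$ (r, c) = - mat_bracket C D' $$ (r, c)"
      using row_rotation_bracket_block[OF so2(2) minus(3) so2(3,4) minus(4) rot2(2), of r] rc 2 so2
      by (simp add: bracket_uminus_entry)
    then show ?thesis
      unfolding X
      using row_rotation_bracket_block[OF so rot, of r] rc 2 by (simp add: J_upper_def)
  next
    case 3
    then show ?thesis
      unfolding X
      using row_rotation_bracket[OF so rot, of r c] rc by (simp add: J_upper_def)
  qed
qed

theorem theorem2:
  fixes n :: nat and J :: "mat_pair \<Rightarrow> mat_pair"
  assumes "n \<ge> 2"
    and "complex_structure n J"
    and "basis_rules n J"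
  shows "integrable_structure n J"
  unfolding integrable_structure_def
proof (intro ballI)
  fix v w assume v: "v \<in> so_prod n" and w: "w \<in> so_prod n"
  have J: "J x = J_wit n x" if "x \<in> so_prod n" for x
    using complex_structure_unique[OF assms(2,3) J_wit_complex_structure J_wit_basis_rules that] .
  \<comment> \<open>\<open>J\<close> and \<open>J_wit n\<close> are known to agree only on
    \<open>so_prod n\<close>, so each argument of \<open>J\<close> in the tensor must lie
    there.\<close>
  have wit: "J_wit n x \<in> so_prod n" for x
    by (simp add: J_wit_def so_prod_def J_comp_so_alg)
  have bracket: "pair_bracket x y \<in> so_prod n" if "x \<in> so_prod n" "y \<in> so_prod n" for x y
    using that by (auto simp: pair_bracket_def so_prod_def so_alg_bracket)
  have "nijenhuis J v w = nijenhuis (J_wit n) v w"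
    using v w by (simp add: nijenhuis_def J wit bracket)
  also have "\<dots> = pair_zero n"
    \<comment> \<open>The component lemma is used with \<open>s = - 1\<close> for the first factor
      and with \<open>s = 1\<close> and the factors exchanged for the second.\<close>
    using v w
    by (auto simp: nijenhuis_def J_wit_def pair_bracket_def pair_zero_def so_prod_def
        intro!: nijenhuis_component J_comp_so_alg row_rotation_J_comp)
  finally show "nijenhuis J v w = pair_zero n" .
qed

end
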